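(* Let $Z\subset\mathbb{P}^n$ be a finite set such that: (i) $\ell(Z)\ge 2n+3$; (ii) $h_Z(2)\le 2n+1$; (iii) there exists $A\subset Z$ such that $\ell(A)=2n+1$ and $A$ is in linear general position. Then $Z$ is in linear general position and it is contained in a rational normal curve of $\mathbb{P}^n$.
   Context: $\mathbb{P}^n=\mathbb{P}^n_{\mathbb{C}}$ is complex projective space, $n\ge 1$. For a finite set $Z\subset\mathbb{P}^n$, $\ell(Z)$ is its cardinality. $h_Z(2)$ is the value in degree 2 of the Hilbert function of $Z$: choosing one representative vector in $\mathbb{C}^{n+1}$ for each point of $Z$, $h_Z(2)$ is the rank of the linear map $S^2\mathbb{C}^{n+1}\to\mathbb{C}^{\ell(Z)}$ evaluating quadratic forms in $n+1$ variables at these vectors (the rank does not depend on the choice of representatives). A finite set $A\subset\mathbb{P}^n$ is in linear general position (LGP) if every subset of $A$ of cardinality at most $\min\{\ell(A),n+1\}$ is linearly independent. A rational normal curve in $\mathbb{P}^n$ is a curve which, up to a projective linear automorphism of $\mathbb{P}^n$, is the image of the degree-$n$ Veronese embedding of $\mathbb{P}^1$; equivalently, an irreducible nondegenerate curve of degree $n$ in $\mathbb{P}^n$. *)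

theory Defs
  imports "HOL-Analysis.Analysis" "HOL-Library.Function_Algebras"
begin

text \<open>
  The index type \<open>'m\<close> has \<open>n + 1\<close> elements; \<open>complex^'m\<close> is the vector space of dimension
  \<open>n + 1\<close> underlying projective \<open>n\<close>-space. A projective point is a one-dimensional linear
  subspace, so sets of projective points are sets of sets of vectors.
\<close>

definition proj_space :: "(complex^'m) set set" where
  "proj_space = {p. vec.subspace p \<and> vec.dim p = 1}"

text \<open>A chosen representative vector of a point; nothing below depends on the choice.\<close>

definition rep :: "(complex^'m) set \<Rightarrow> complex^'m" where
  "rep p = (SOME v. v \<in> p \<and> v \<noteq> 0)"

text \<open>Distinct points have distinct representatives, so passing to the image loses no points.\<close>

definition points_independent :: "(complex^'m) set set \<Rightarrow> bool" where
  "points_independent S \<longleftrightarrow> vec.independent (rep ` S)"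

definition linear_general_position :: "(complex^'m) set set \<Rightarrow> bool" where
  "linear_general_position A \<longleftrightarrow>
     (\<forall>S \<subseteq> A. card S \<le> min (card A) CARD('m) \<longrightarrow> points_independent S)"

definition quadratic_forms :: "(complex^'m \<Rightarrow> complex) set" where
  "quadratic_forms = range (\<lambda>Q :: complex^'m^'m. \<lambda>v. \<Sum>i\<in>UNIV. \<Sum>j\<in>UNIV. Q $ i $ j * v $ i * v $ j)"

text \<open>
  Complex-valued functions, with pointwise operations, as a complex vector space. For a finite
  set \<open>Z\<close> of points, the functions vanishing outside \<open>Z\<close> form a copy of the
  coordinate space with one coordinate for each point of \<open>Z\<close>.
\<close>

interpretation fun_space: vector_space "\<lambda>(c::complex) (f :: 'a \<Rightarrow> complex) x. c * f x"
  by unfold_locales (simp_all add: fun_eq_iff algebra_simps)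

definition evaluation :: "(complex^'m) set set \<Rightarrow> (complex^'m \<Rightarrow> complex) \<Rightarrow> (complex^'m) set \<Rightarrow> complex" where
  "evaluation Z q = (\<lambda>p. if p \<in> Z then q (rep p) else 0)"

text \<open>The value in degree 2 of the Hilbert function: the rank of evaluation on quadratic forms.\<close>

definition hilbert2 :: "(complex^'m) set set \<Rightarrow> nat" where
  "hilbert2 Z = fun_space.dim (evaluation Z ` quadratic_forms)"

text \<open>
  The enumeration \<open>e\<close> of the coordinates by \<open>0, \<dots>, n\<close> fixes which coordinate carries
  which monomial of degree \<open>n = CARD('m) - 1\<close> in \<open>s\<close>, \<open>t\<close>.
\<close>

definition veronese :: "('m \<Rightarrow> nat) \<Rightarrow> complex \<Rightarrow> complex \<Rightarrow> complex^'m" where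
  "veronese e s t = (\<chi> i. s ^ (CARD('m) - 1 - e i) * t ^ e i)"

definition veronese_curve :: "('m \<Rightarrow> nat) \<Rightarrow> (complex^'m) set set" where
  "veronese_curve e = {vec.span {veronese e s t} | s t. (s, t) \<noteq> (0, 0)}"

definition rational_normal_curve :: "(complex^'m) set set \<Rightarrow> bool" where
  "rational_normal_curve C \<longleftrightarrow>
     (\<exists>(e :: 'm \<Rightarrow> nat) (g :: complex^'m^'m).
        bij_betw e UNIV {0..<CARD('m)} \<and> invertible g \<and>
        C = (\<lambda>p. (\<lambda>v. g *v v) ` p) ` veronese_curve e)"

end

theory Submission
  imports Defs
begin

text \<open>
  A set of \<open>2n + 1\<close> points in general position imposes independent conditions on quadrics (split the
  complement of a point into two hyperplanes), so the bound on \<open>h\<^sub>Z(2)\<close> says that every quadric through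
  such a subset of \<open>Z\<close> contains \<open>Z\<close>. Suitable quadrics then show that \<open>A\<close> can absorb any further point
  of \<open>Z\<close> and stay in general position, and exchanging points one at a time gives general position of
  \<open>Z\<close>.

  For the curve, choose \<open>n\<close> points of \<open>Z\<close>, let \<open>y = 0\<close> be their hyperplane and let \<open>t\<^sub>i = x\<^sub>i / y\<close> be the
  affine coordinates of the remaining points, which are at least \<open>n + 3\<close> in number. The quadrics
  \<open>x\<^sub>i x\<^sub>j + y l\<close> show that \<open>t\<^sub>i t\<^sub>j\<close> agrees with an affine function on these points. A dimension count
  forces this function to involve only \<open>t\<^sub>i\<close> and \<open>t\<^sub>j\<close>, so every \<open>t\<^sub>j\<close> is a Moebius transform of \<open>t\<^sub>1\<close>;
  clearing denominators parametrizes the curve.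
\<close>

section \<open>Affine coordinates with affine products\<close>

text \<open>The situation after division by \<open>y\<close>: \<open>I\<close> spans the hyperplane
  \<open>y = 0\<close>, \<open>B\<close> holds the remaining points, and the \<open>t i\<close> are
  affine coordinates. \<open>inj_t\<close> and \<open>affinely_independent\<close> record general
  position, \<open>mult_affine\<close> the quadrics.\<close>

locale affine_system =
  fixes I :: "'i set" and B :: "'b set" and t :: "'i \<Rightarrow> 'b \<Rightarrow> 'k::field"
  assumes finite_I: "finite I" and finite_B: "finite B"
    and card_B: "card B \<ge> card I + 3"
    and inj_t: "i \<in> I \<Longrightarrow> inj_on (t i) B"
    and affinely_independent:
      "\<lbrakk>U \<subseteq> B; card U = card I + 1; \<And>b. b \<in> U \<Longrightarrow> d + (\<Sum>k\<in>I. c k * t k b) = 0\<rbrakk>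
        \<Longrightarrow> d = 0 \<and> (\<forall>k\<in>I. c k = 0)"
    and mult_affine:
      "\<lbrakk>i \<in> I; j \<in> I; i \<noteq> j\<rbrakk> \<Longrightarrow> \<exists>d c. \<forall>b\<in>B. t i b * t j b = d + (\<Sum>k\<in>I. c k * t k b)"
begin

definition affine_fun :: "('b \<Rightarrow> 'k) set" where
  "affine_fun = {f. \<exists>d c. \<forall>b\<in>B. f b = d + (\<Sum>k\<in>I. c k * t k b)}"

lemma affine_funI: "(\<And>b. b \<in> B \<Longrightarrow> f b = d + (\<Sum>k\<in>I. c k * t k b)) \<Longrightarrow> f \<in> affine_fun"
  unfolding affine_fun_def by blast

lemma affine_fun_cong: "f \<in> affine_fun \<Longrightarrow> (\<And>b. b \<in> B \<Longrightarrow> g b = f b) \<Longrightarrow> g \<in> affine_fun"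
  unfolding affine_fun_def by auto

lemma affine_fun_add:
  assumes "f \<in> affine_fun" "g \<in> affine_fun"
  shows "(\<lambda>b. f b + g b) \<in> affine_fun"
proof -
  obtain d c d' c' where "\<forall>b\<in>B. f b = d + (\<Sum>k\<in>I. c k * t k b)"
    "\<forall>b\<in>B. g b = d' + (\<Sum>k\<in>I. c' k * t k b)"
    using assms unfolding affine_fun_def by blast
  then show ?thesis
    by (intro affine_funI[of _ "d + d'" "\<lambda>k. c k + c' k"]) (simp add: sum.distrib algebra_simps)
qed

lemma affine_fun_scale:
  assumes "f \<in> affine_fun"
  shows "(\<lambda>b. a * f b) \<in> affine_fun"
proof -
  obtain d c where "\<forall>b\<in>B. f b = d + (\<Sum>k\<in>I. c k * t k b)"
    using assms unfolding affine_fun_def by blast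
  then show ?thesis
    by (intro affine_funI[of _ "a * d" "\<lambda>k. a * c k"])
      (simp add: sum_distrib_left algebra_simps)
qed

lemma affine_fun_diff:
  assumes "f \<in> affine_fun" "g \<in> affine_fun"
  shows "(\<lambda>b. f b - g b) \<in> affine_fun"
  using affine_fun_add[OF assms(1) affine_fun_scale[OF assms(2), of "-1"]] by simp

lemma affine_fun_const: "(\<lambda>b. a) \<in> affine_fun"
  by (rule affine_funI[of _ a "\<lambda>_. 0"]) simp

lemma affine_fun_sum:
  "finite S \<Longrightarrow> (\<And>k. k \<in> S \<Longrightarrow> f k \<in> affine_fun) \<Longrightarrow> (\<lambda>b. \<Sum>k\<in>S. f k b) \<in> affine_fun"
  by (induction S rule: finite_induct) (auto intro: affine_fun_const affine_fun_add)

lemma coordinate_affine_fun: "k \<in> I \<Longrightarrow> t k \<in> affine_fun"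
  by (rule affine_funI[of _ 0 "\<lambda>i. if i = k then 1 else 0"])
    (simp add: finite_I if_distrib[of "\<lambda>x. x * _"] cong: if_cong)

text \<open>Multiplication by \<open>t k\<close> turns every other coordinate into a mixed product,
  affine by \<open>mult_affine\<close>; only the square of \<open>t k\<close> may leave the
  space.\<close>

lemma mult_coordinate:
  assumes k: "k \<in> I" and f: "\<And>b. b \<in> B \<Longrightarrow> f b = d + (\<Sum>i\<in>I. c i * t i b)"
  shows "(\<lambda>b. t k b * f b - c k * (t k b)^2) \<in> affine_fun"
proof -
  have "(\<lambda>b. d * t k b + (\<Sum>i\<in>I - {k}. c i * (t k b * t i b))) \<in> affine_fun"
  proof (intro affine_fun_add affine_fun_scale affine_fun_sum coordinate_affine_fun k)
    fix i assume "i \<in> I - {k}"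
    then show "(\<lambda>b. t k b * t i b) \<in> affine_fun"
      using mult_affine[of k i] k unfolding affine_fun_def by auto
  qed (use finite_I in auto)
  then show ?thesis
  proof (rule affine_fun_cong)
    fix b assume b: "b \<in> B"
    have "(\<Sum>i\<in>I. c i * t i b) = c k * t k b + (\<Sum>i\<in>I - {k}. c i * t i b)"
      using sum.remove[OF finite_I k] by simp
    then show "t k b * f b - c k * (t k b)^2
        = d * t k b + (\<Sum>i\<in>I - {k}. c i * (t k b * t i b))"
      by (simp add: f[OF b] algebra_simps sum_distrib_left power2_eq_square)
  qed
qed

lemma affine_basis_exists:
  obtains U where "U \<subseteq> B" "card U = card I + 1"
proof -
  have "card I + 1 \<le> card B" using card_B by simp
  then show thesis using that by (rule obtain_subset_with_card_n)
qed

text \<open>All coefficients vanish by \<open>affinely_independent\<close>, so values at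
  \<open>card I + 1\<close> points of \<open>B\<close> determine an affine function on
  \<open>B\<close>.\<close>

lemma affine_fun_eq_0:
  assumes "f \<in> affine_fun" "U \<subseteq> B" "card U = card I + 1" "\<And>b. b \<in> U \<Longrightarrow> f b = 0" "b \<in> B"
  shows "f b = 0"
proof -
  obtain d c where f: "\<forall>b\<in>B. f b = d + (\<Sum>k\<in>I. c k * t k b)"
    using assms(1) unfolding affine_fun_def by blast
  then have "d = 0 \<and> (\<forall>k\<in>I. c k = 0)"
    using assms(2-4) by (intro affinely_independent[of U]) (auto simp: subset_iff)
  then show ?thesis using f assms(5) by simp
qed

text \<open>Otherwise the affine functions together with \<open>(t k)\<^sup>2\<close> would be closed under multiplication by
  \<open>t k\<close>, hence by Lagrange interpolation contain all functions on \<open>B\<close>, in dimension at most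
  \<open>card I + 2\<close>.\<close>

lemma cube_not_affine_mod_square:
  assumes k: "k \<in> I"
  shows "(\<lambda>b. t k b ^ 3 - a * (t k b)^2) \<notin> affine_fun"
proof
  assume cube: "(\<lambda>b. t k b ^ 3 - a * (t k b)^2) \<in> affine_fun"
  define M where "M = {f. \<exists>c. (\<lambda>b. f b - c * (t k b)^2) \<in> affine_fun}"
  \<comment> \<open>\<open>mult_coordinate\<close> handles the affine part of \<open>f\<close>, the
    assumption on the cube its multiple of \<open>(t k)^2\<close>.\<close>
  have step: "(\<lambda>b. (t k b - r) * f b) \<in> M" if f: "f \<in> M" for f r
  proof -
    obtain c where c: "(\<lambda>b. f b - c * (t k b)^2) \<in> affine_fun"
      using f unfolding M_def by blast
    then obtain d e where de: "\<And>b. b \<in> B \<Longrightarrow> f b - c * (t k b)^2 = d + (\<Sum>i\<in>I. e i * t i b)"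
      by (auto simp: affine_fun_def)
    have "(\<lambda>b. (t k b * (f b - c * (t k b)^2) - e k * (t k b)^2)
        + c * (t k b ^ 3 - a * (t k b)^2) - r * (f b - c * (t k b)^2)) \<in> affine_fun"
      by (rule affine_fun_diff[OF affine_fun_add[OF mult_coordinate[OF k de]
            affine_fun_scale[OF cube]] affine_fun_scale[OF c]])
    then have "(\<lambda>b. (t k b - r) * f b - (e k + c * a - r * c) * (t k b)^2) \<in> affine_fun"
      by (rule affine_fun_cong) (simp add: algebra_simps power2_eq_square power3_eq_cube)
    then show ?thesis by (auto simp: M_def)
  qed
  have prod: "(\<lambda>b. \<Prod>b'\<in>S. (t k b - t k b')) \<in> M" if "finite S" for S
    using that
  proof (induction S rule: finite_induct)
    case empty
    have "(\<lambda>b. 1 - 0 * (t k b)^2) \<in> affine_fun" using affine_fun_const[of 1] by simp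
    then show ?case unfolding M_def by (simp, blast)
  qed (simp add: step)
  obtain U where U: "U \<subseteq> B" "card U = card I + 1"
    by (rule affine_basis_exists)
  \<comment> \<open>Two points remain outside \<open>U\<close>, one more than the single dimension
    that \<open>(t k)^2\<close> can add.\<close>
  have "card (B - U) \<ge> 2"
    using card_B U finite_B by (simp add: card_Diff_subset finite_subset)
  then obtain u v where uv: "u \<in> B - U" "v \<in> B - U" "u \<noteq> v"
    using card_le_Suc0_iff_eq[of "B - U"] finite_B by auto
  \<comment> \<open>Lagrange functions up to scaling; injectivity of \<open>t k\<close> keeps
    \<open>F u u\<close> nonzero.\<close>
  define F where "F = (\<lambda>u b. \<Prod>b'\<in>B - {u}. (t k b - t k b'))"
  have F0: "F w b = 0" if "b \<in> B" "b \<noteq> w" for w b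
    unfolding F_def using that finite_B by (intro prod_zero) auto
  have F1: "F w w \<noteq> 0" if "w \<in> B" for w
    unfolding F_def using that finite_B inj_t[OF k] by (auto simp: inj_on_def)
  obtain c c' where c: "(\<lambda>b. F u b - c * (t k b)^2) \<in> affine_fun"
    and c': "(\<lambda>b. F v b - c' * (t k b)^2) \<in> affine_fun"
    using prod[of "B - {u}"] prod[of "B - {v}"] finite_B unfolding F_def M_def by auto
  \<comment> \<open>Eliminating the square leaves an affine function that vanishes on
    \<open>U\<close>, hence on \<open>B\<close>. Its value at \<open>v\<close> gives
    \<open>c = 0\<close>, so \<open>F u\<close> itself is affine and vanishes on \<open>U\<close>, a
    contradiction at \<open>u\<close>.\<close>
  have "(\<lambda>b. c' * (F u b - c * (t k b)^2) - c * (F v b - c' * (t k b)^2)) \<in> affine_fun"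
    by (rule affine_fun_diff[OF affine_fun_scale[OF c] affine_fun_scale[OF c']])
  then have "(\<lambda>b. c' * F u b - c * F v b) \<in> affine_fun"
    by (rule affine_fun_cong) (simp add: algebra_simps)
  from affine_fun_eq_0[OF this U(1,2)] have z: "c' * F u b - c * F v b = 0" if "b \<in> B" for b
    using that uv U F0 by (metis DiffD2 mult_zero_right right_minus_eq subsetD)
  have "c = 0" using z[of v] F0[of v u] F1[of v] uv by auto
  then have "F u u = 0"
    using affine_fun_eq_0[OF c U(1,2), of u] uv U F0 by (metis DiffD1 DiffD2 mult_zero_left diff_zero subsetD)
  then show False using F1 uv by blast
qed

text \<open>If \<open>t i t j\<close> involved a third coordinate \<open>t k\<close>, then comparing \<open>t k (t i t j)\<close> with
  \<open>t j (t i t k)\<close> would make \<open>(t k)\<^sup>2\<close> a multiple of \<open>(t j)\<^sup>2\<close> modulo affine functions, and one more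
  multiplication by \<open>t k\<close> would express its cube as excluded above.\<close>

lemma moebius_relation:
  assumes ij: "i \<in> I" "j \<in> I" "i \<noteq> j"
  shows "\<exists>\<alpha> \<beta> \<gamma>. \<forall>b\<in>B. t i b * t j b = \<alpha> * t i b + \<beta> * t j b + \<gamma>"
proof -
  obtain d c where c: "\<And>b. b \<in> B \<Longrightarrow> t i b * t j b = d + (\<Sum>k\<in>I. c k * t k b)"
    using mult_affine[OF ij] by blast
  have "c k = 0" if k: "k \<in> I" "k \<noteq> i" "k \<noteq> j" for k
  proof (rule ccontr)
    assume ck: "c k \<noteq> 0"
    obtain d' c' where c': "\<And>b. b \<in> B \<Longrightarrow> t i b * t k b = d' + (\<Sum>k\<in>I. c' k * t k b)"
      using mult_affine[of i k] ij k by blast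
    obtain d'' c'' where c'': "\<And>b. b \<in> B \<Longrightarrow> t j b * t k b = d'' + (\<Sum>k\<in>I. c'' k * t k b)"
      using mult_affine[of j k] ij k by blast
    define l where "l = c' j / c k"
    define h where "h = (\<lambda>b. (t k b)^2 - l * (t j b)^2)"
    have "(\<lambda>b. (1 / c k) * ((t j b * (t i b * t k b) - c' j * (t j b)^2)
        - (t k b * (t i b * t j b) - c k * (t k b)^2))) \<in> affine_fun"
      by (rule affine_fun_scale[OF affine_fun_diff[OF mult_coordinate[OF ij(2) c']
            mult_coordinate[OF k(1) c]]])
    then have h: "h \<in> affine_fun"
      by (rule affine_fun_cong) (use ck in \<open>simp add: h_def l_def field_simps\<close>)
    then obtain e e' where e: "\<And>b. b \<in> B \<Longrightarrow> h b = e + (\<Sum>k\<in>I. e' k * t k b)"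
      unfolding affine_fun_def by blast
    \<comment> \<open>The products \<open>t k * (t j)^2\<close> cancel, and subtracting
      \<open>c'' j * h\<close> trades the leftover multiple of \<open>(t j)^2\<close> for one of
      \<open>(t k)^2\<close>.\<close>
    have "(\<lambda>b. (t k b * h b - e' k * (t k b)^2)
        + l * (t j b * (t j b * t k b) - c'' j * (t j b)^2) - c'' j * h b) \<in> affine_fun"
      by (rule affine_fun_diff[OF affine_fun_add[OF mult_coordinate[OF k(1) e]
            affine_fun_scale[OF mult_coordinate[OF ij(2) c'']]] affine_fun_scale[OF h]])
    then have "(\<lambda>b. t k b ^ 3 - (e' k + c'' j) * (t k b)^2) \<in> affine_fun"
      by (rule affine_fun_cong) (simp add: h_def algebra_simps power2_eq_square power3_eq_cube)
    then show False using cube_not_affine_mod_square[OF k(1)] by blast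
  qed
  then have "(\<Sum>k\<in>I. c k * t k b) = c i * t i b + c j * t j b" for b
    using sum.mono_neutral_right[OF finite_I, of "{i, j}" "\<lambda>k. c k * t k b"] ij by auto
  then show ?thesis using c by (intro exI[of _ "c i"] exI[of _ "c j"] exI[of _ d]) auto
qed

text \<open>The relation reads \<open>(t i - \<beta>) * (t j - \<alpha>) = \<alpha> * \<beta> +
  \<gamma>\<close>. If the right side were 0, a fibre of \<open>t i\<close> and a fibre of
  \<open>t j\<close> would cover \<open>B\<close>, each with at most one point.\<close>

lemma moebius_nondegenerate:
  assumes ij: "i \<in> I" "j \<in> I"
    and rel: "\<And>b. b \<in> B \<Longrightarrow> t i b * t j b = \<alpha> * t i b + \<beta> * t j b + \<gamma>"
  shows "\<alpha> * \<beta> + \<gamma> \<noteq> 0"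
proof
  assume deg: "\<alpha> * \<beta> + \<gamma> = 0"
  have "(t i b - \<beta>) * (t j b - \<alpha>) = 0" if "b \<in> B" for b
    using rel[OF that] deg by (simp add: algebra_simps)
  then have sub: "B \<subseteq> {b \<in> B. t i b = \<beta>} \<union> {b \<in> B. t j b = \<alpha>}" by auto
  have fiber: "card {b \<in> B. t k b = r} \<le> 1" if "k \<in> I" for k r
    using card_le_Suc0_iff_eq[of "{b \<in> B. t k b = r}"] finite_B inj_t[OF that]
    by (auto simp: inj_on_def)
  have "card B \<le> card ({b \<in> B. t i b = \<beta>} \<union> {b \<in> B. t j b = \<alpha>})"
    using sub finite_B by (intro card_mono) auto
  also have "\<dots> \<le> card {b \<in> B. t i b = \<beta>} + card {b \<in> B. t j b = \<alpha>}" by (rule card_Un_le)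
  also have "\<dots> \<le> 1 + 1" by (intro add_mono fiber ij)
  finally show False using card_B by simp
qed

text \<open>\<open>\<beta>\<close> is the pole of \<open>t j\<close> as a Moebius function of
  \<open>t i\<close>; the relation at a point with this value would force degeneracy.\<close>

lemma moebius_pole_notin_range:
  assumes "i \<in> I" "j \<in> I"
    and "\<And>b. b \<in> B \<Longrightarrow> t i b * t j b = \<alpha> * t i b + \<beta> * t j b + \<gamma>" "b \<in> B"
  shows "t i b \<noteq> \<beta>"
  using moebius_nondegenerate[OF assms(1-3)] assms(3)[OF assms(4)] by (auto simp: algebra_simps)

text \<open>With a common pole, \<open>t j - \<alpha>\<close> and \<open>t k - \<alpha>'\<close> are
  both constant multiples of \<open>1 / (t i - \<beta>)\<close>, hence proportional, which is a
  forbidden affine relation.\<close>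

lemma moebius_poles_distinct:
  assumes ij: "i \<in> I" "j \<in> I" "k \<in> I" "j \<noteq> k"
    and j: "\<And>b. b \<in> B \<Longrightarrow> t i b * t j b = \<alpha> * t i b + \<beta> * t j b + \<gamma>"
    and k: "\<And>b. b \<in> B \<Longrightarrow> t i b * t k b = \<alpha>' * t i b + \<beta>' * t k b + \<gamma>'"
  shows "\<beta> \<noteq> \<beta>'"
proof
  assume eq: "\<beta> = \<beta>'"
  define D D' where "D = \<alpha> * \<beta> + \<gamma>" and "D' = \<alpha>' * \<beta> + \<gamma>'"
  \<comment> \<open>Coefficients of \<open>D' * (t j - \<alpha>) - D * (t k - \<alpha>')\<close>
    apart from its constant term.\<close>
  define c where "c = (\<lambda>l. if l = j then D' else if l = k then - D else 0)"
  obtain U where U: "U \<subseteq> B" "card U = card I + 1"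
    by (rule affine_basis_exists)
  have "D * \<alpha>' - D' * \<alpha> + (\<Sum>l\<in>I. c l * t l b) = 0" if "b \<in> U" for b
  proof -
    have b: "b \<in> B" using that U by blast
    have "(\<Sum>l\<in>I. c l * t l b) = (\<Sum>l\<in>{j, k}. c l * t l b)"
      using ij finite_I by (intro sum.mono_neutral_right) (auto simp: c_def)
    then have s: "(\<Sum>l\<in>I. c l * t l b) = D' * t j b - D * t k b" using ij(4) by (simp add: c_def)
    have e: "(t i b - \<beta>) * (t j b - \<alpha>) = D" "(t i b - \<beta>) * (t k b - \<alpha>') = D'"
      using j[OF b] k[OF b] eq by (simp_all add: D_def D'_def algebra_simps)
    have "(t i b - \<beta>) * (D' * (t j b - \<alpha>) - D * (t k b - \<alpha>'))
        = D' * ((t i b - \<beta>) * (t j b - \<alpha>)) - D * ((t i b - \<beta>) * (t k b - \<alpha>'))"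
      by (simp only: algebra_simps)
    also have "\<dots> = 0" unfolding e by simp
    finally have "(t i b - \<beta>) * (D' * (t j b - \<alpha>) - D * (t k b - \<alpha>')) = 0" .
    moreover have "t i b \<noteq> \<beta>" by (rule moebius_pole_notin_range[OF ij(1,2) j b])
    ultimately have "D' * (t j b - \<alpha>) - D * (t k b - \<alpha>') = 0" by simp
    then show ?thesis unfolding s by (simp add: algebra_simps)
  qed
  from affinely_independent[OF U this] have "c j = 0" using ij by blast
  then show False
    using moebius_nondegenerate[OF ij(1,3) k] eq by (simp add: c_def D'_def)
qed

end

section \<open>Linear and quadratic forms\<close>

definition linear_form :: "(complex^'m \<Rightarrow> complex) \<Rightarrow> bool" where
  "linear_form f \<longleftrightarrow> Vector_Spaces.linear (*s) (*) f"

interpretation linear_forms: vector_space_pair "(*s) :: complex \<Rightarrow> complex^'m \<Rightarrow> complex^'m" "(*)"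
  by unfold_locales (simp_all add: algebra_simps)

lemma linear_form_add: "linear_form f \<Longrightarrow> f (u + v) = f u + f v"
  and linear_form_scale: "linear_form f \<Longrightarrow> f (c *s v) = c * f v"
  unfolding linear_form_def by (rule linear_forms.linear_add linear_forms.linear_scale, assumption)+

lemma linear_form_sum: "linear_form f \<Longrightarrow> f (\<Sum>i\<in>S. g i) = (\<Sum>i\<in>S. f (g i))"
  unfolding linear_form_def by (rule linear_forms.linear_sum)

lemma linear_form_eq_0_on_span:
  "\<lbrakk>linear_form f; \<And>v. v \<in> S \<Longrightarrow> f v = 0; v \<in> vec.span S\<rbrakk> \<Longrightarrow> f v = 0"
  unfolding linear_form_def using linear_forms.linear_eq_0_on_span by blast

lemma linear_form_extend:
  "vec.independent S \<Longrightarrow> \<exists>f. linear_form f \<and> (\<forall>v\<in>S. f v = g v)"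
  unfolding linear_form_def by (rule linear_forms.linear_independent_extend)

lemma linear_form_coordinates:
  assumes "linear_form f"
  shows "f v = (\<Sum>i\<in>UNIV. f (axis i 1) * v $ i)"
proof -
  have "f v = f (\<Sum>i\<in>UNIV. v $ i *s axis i 1)" by (simp add: basis_expansion)
  then show ?thesis using assms by (simp add: linear_form_sum linear_form_scale mult.commute)
qed

lemma span_eq_UNIV:
  fixes S :: "(complex^'m) set"
  assumes "vec.independent S" "card S = CARD('m)"
  shows "vec.span S = UNIV"
proof -
  have "vec.dim (UNIV :: (complex^'m) set) \<le> card S" by (simp only: assms(2) vec_dim_card)
  then show ?thesis using vec.card_ge_dim_independent[of S UNIV] assms(1) by blast
qed

lemma dual_basis:
  fixes E :: "(complex^'m) set"
  assumes "vec.independent E" "card E = CARD('m)"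
  obtains x where "\<And>e. linear_form (x e)"
    and "\<And>v. v = (\<Sum>e\<in>E. x e v *s e)"
    and "\<And>e e'. e' \<in> E \<Longrightarrow> x e e' = (if e = e' then 1 else 0)"
proof
  have fin: "finite E" using assms(1) by (rule vec.finiteI_independent)
  note span = span_eq_UNIV[OF assms]
  show "linear_form (\<lambda>v. vec.representation E v e)" for e
    unfolding linear_form_def
    by unfold_locales (simp_all add: vec.representation_add vec.representation_scale assms span)
  show "v = (\<Sum>e\<in>E. vec.representation E v e *s e)" for v
    using vec.sum_representation_eq[OF assms(1) _ fin subset_refl, of v] span by simp
  show "vec.representation E e' e = (if e = e' then 1 else 0)" if "e' \<in> E" for e e'
    using vec.representation_basis[OF assms(1) that] by auto
qed

section \<open>Quadratic forms and the construction of quadrics\<close>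

lemma quadratic_forms_mult:
  assumes "linear_form f" "linear_form g"
  shows "(\<lambda>v. f v * g v) \<in> quadratic_forms"
  unfolding quadratic_forms_def
proof (rule image_eqI)
  show "(\<lambda>v. f v * g v) = (\<lambda>v. \<Sum>i\<in>UNIV. \<Sum>j\<in>UNIV.
      (\<chi> i j. f (axis i 1) * g (axis j 1)) $ i $ j * v $ i * v $ j)"
  proof
    fix v
    show "f v * g v = (\<Sum>i\<in>UNIV. \<Sum>j\<in>UNIV.
      (\<chi> i j. f (axis i 1) * g (axis j 1)) $ i $ j * v $ i * v $ j)"
      using linear_form_coordinates[OF assms(1), of v] linear_form_coordinates[OF assms(2), of v]
      by (simp add: sum_product algebra_simps)
  qed
qed simp

lemma quadratic_forms_linear:
  assumes "q \<in> quadratic_forms" "q' \<in> quadratic_forms"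
  shows "(\<lambda>v. q v + c * q' v) \<in> quadratic_forms"
proof -
  obtain Q Q' where q: "q = (\<lambda>v. \<Sum>i\<in>UNIV. \<Sum>j\<in>UNIV. Q $ i $ j * v $ i * v $ j)"
    "q' = (\<lambda>v. \<Sum>i\<in>UNIV. \<Sum>j\<in>UNIV. Q' $ i $ j * v $ i * v $ j)"
    using assms unfolding quadratic_forms_def by blast
  show ?thesis
    unfolding quadratic_forms_def
    by (rule image_eqI[of _ _ "\<chi> i j. Q $ i $ j + c * Q' $ i $ j"])
      (simp_all add: q sum.distrib sum_distrib_left algebra_simps)
qed

text \<open>Independence of \<open>S\<close> allows \<open>l\<close> to be prescribed as
  \<open>- f g / y\<close> on \<open>S\<close>. Where \<open>y = 0\<close> the quadric reduces to
  \<open>f g\<close>, which later supplies further zeros.\<close>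

lemma quadric_through_independent:
  assumes "linear_form f" "linear_form g" "linear_form y" "vec.independent S" "\<And>v. v \<in> S \<Longrightarrow> y v \<noteq> 0"
  obtains l where "linear_form l" "(\<lambda>v. f v * g v + y v * l v) \<in> quadratic_forms"
    "\<And>v. v \<in> S \<Longrightarrow> f v * g v + y v * l v = 0"
proof -
  obtain l where l: "linear_form l" "\<And>v. v \<in> S \<Longrightarrow> l v = - (f v * g v) / y v"
    using linear_form_extend[OF assms(4), of "\<lambda>v. - (f v * g v) / y v"] by blast
  show ?thesis
  proof (rule that[OF l(1)])
    show "(\<lambda>v. f v * g v + y v * l v) \<in> quadratic_forms"
      using quadratic_forms_linear[OF quadratic_forms_mult quadratic_forms_mult, of f g y l 1] assms l
      by simp
  qed (use l(2) assms(5) in auto)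
qed

section \<open>General position of vectors\<close>

definition general_position :: "(complex^'m) set \<Rightarrow> bool" where
  "general_position X \<longleftrightarrow> finite X \<and> (\<forall>S\<subseteq>X. card S \<le> CARD('m) \<longrightarrow> vec.independent S)"

lemma general_position_subset: "general_position X \<Longrightarrow> Y \<subseteq> X \<Longrightarrow> general_position Y"
  unfolding general_position_def using finite_subset by blast

lemma general_position_finite: "general_position X \<Longrightarrow> finite X"
  and general_position_independent:
    "\<lbrakk>general_position (X :: (complex^'m) set); S \<subseteq> X; card S \<le> CARD('m)\<rbrakk> \<Longrightarrow> vec.independent S"
  unfolding general_position_def by blast+

text \<open>\<open>T\<close> and \<open>b\<close> form a basis, so a form vanishing on them would be
  zero; \<open>c\<close> witnesses that \<open>y\<close> is not.\<close>

lemma hyperplane_avoids: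
  fixes X :: "(complex^'m) set"
  assumes "general_position X" "T \<subseteq> X" "card T + 1 = CARD('m)" "b \<in> X - T"
    and y: "linear_form y" "\<And>v. v \<in> T \<Longrightarrow> y v = 0" "y c \<noteq> 0"
  shows "y b \<noteq> 0"
proof
  assume "y b = 0"
  have "finite T" using assms(1,2) by (meson general_position_finite finite_subset)
  then have "card (insert b T) = CARD('m)" using assms(3,4) by simp
  moreover then have "vec.independent (insert b T)"
    using assms(2,4) by (intro general_position_independent[OF assms(1)]) simp_all
  ultimately have c: "c \<in> vec.span (insert b T)" using span_eq_UNIV by blast
  have "y v = 0" if "v \<in> insert b T" for v using that y(2) \<open>y b = 0\<close> by blast
  from linear_form_eq_0_on_span[OF y(1) this c] show False using y(3) by simp
qed

text \<open>The \<open>2n\<close> vectors other than \<open>a\<close> split into halves of size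
  \<open>n\<close>. Each half is independent together with \<open>a\<close>, so some linear form
  vanishes on it and is 1 at \<open>a\<close>; the quadric is the product of the two forms.\<close>

lemma separating_quadric:
  fixes X :: "(complex^'m) set"
  assumes X: "general_position X" "card X + 1 = 2 * CARD('m)" "a \<in> X"
  obtains q where "q \<in> quadratic_forms" "q a \<noteq> 0" "\<And>b. b \<in> X - {a} \<Longrightarrow> q b = 0"
proof -
  note fin = general_position_finite[OF X(1)]
  have "CARD('m) - 1 \<le> card (X - {a})" using X fin by simp
  then obtain T where T: "T \<subseteq> X - {a}" "card T = CARD('m) - 1"
    by (meson obtain_subset_with_card_n)
  have form: "\<exists>f. linear_form f \<and> f a = 1 \<and> (\<forall>v\<in>S. f v = 0)" if "S \<subseteq> X - {a}" "card S = CARD('m) - 1" for S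
  proof -
    have "card (insert a S) \<le> CARD('m)"
      using that card_insert_le_m1[of "CARD('m)" S a] by simp
    then have "vec.independent (insert a S)"
      using that X by (intro general_position_independent[OF X(1)]) auto
    then obtain f where "linear_form f" "\<forall>v\<in>insert a S. f v = (if v = a then 1 else 0)"
      using linear_form_extend[where g = "\<lambda>v. if v = a then 1 else 0"] by blast
    then show ?thesis using that(1) by (intro exI[of _ f]) auto
  qed
  obtain f where f: "linear_form f" "f a = 1" "\<forall>v\<in>T. f v = 0"
    using form[OF T] by blast
  have "card (X - {a} - T) = CARD('m) - 1"
    using T X fin by (simp add: card_Diff_subset finite_subset[OF T(1)])
  then obtain g where g: "linear_form g" "g a = 1" "\<forall>v\<in>X - {a} - T. g v = 0"
    using form[of "X - {a} - T"] by blast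
  show ?thesis
    using that[of "\<lambda>v. f v * g v"] quadratic_forms_mult[OF f(1) g(1)] f g by auto
qed

section \<open>Evaluation at points and the Hilbert function\<close>

lemma sum_fun_apply: "(\<Sum>i\<in>S. f i) x = (\<Sum>i\<in>S. f i x)"
  for f :: "'a \<Rightarrow> 'b \<Rightarrow> 'c::comm_monoid_add"
  by (induction S rule: infinite_finite_induct) simp_all

text \<open>The separating quadrics have independent evaluations, since a vanishing combination
  taken at one point of \<open>S\<close> isolates one coefficient.\<close>

lemma card_le_hilbert2:
  assumes "finite Z" "S \<subseteq> Z"
    and sep: "\<And>p. p \<in> S \<Longrightarrow> \<exists>q\<in>quadratic_forms. q (rep p) \<noteq> 0 \<and> (\<forall>p'\<in>S - {p}. q (rep p') = 0)"
  shows "card S \<le> hilbert2 Z"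
proof -
  have finS: "finite S" using assms finite_subset by blast
  obtain q where q: "\<And>p. p \<in> S \<Longrightarrow> q p \<in> quadratic_forms" "\<And>p. p \<in> S \<Longrightarrow> q p (rep p) \<noteq> 0"
    "\<And>p p'. p \<in> S \<Longrightarrow> p' \<in> S \<Longrightarrow> p' \<noteq> p \<Longrightarrow> q p (rep p') = 0"
    using sep by (metis DiffI singletonD)
  define F where "F = (\<lambda>p. evaluation Z (q p))"
  have F: "F p p \<noteq> 0" "p' \<noteq> p \<Longrightarrow> F p p' = 0" if "p \<in> S" "p' \<in> S" for p p'
    using q that assms(2) by (auto simp: F_def evaluation_def)
  then have inj: "inj_on F S" by (metis inj_onI)
  have ind: "fun_space.independent (F ` S)"
    unfolding fun_space.independent_explicit_finite_subsets
  proof (intro allI impI ballI)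
    fix U u f assume U: "U \<subseteq> F ` S" "finite U" "(\<Sum>v\<in>U. (\<lambda>x. u v * v x)) = 0" "f \<in> U"
    then obtain p where p: "p \<in> S" "f = F p" by blast
    have "0 = (\<Sum>v\<in>U. u v * v p)" using fun_cong[OF U(3), of p] by (simp add: sum_fun_apply)
    also have "\<dots> = (\<Sum>v\<in>{f}. u v * v p)"
    proof (rule sum.mono_neutral_right)
      show "\<forall>v\<in>U - {f}. u v * v p = 0"
      proof
        fix v assume v: "v \<in> U - {f}"
        then obtain p' where "p' \<in> S" "v = F p'" using U(1) by blast
        then show "u v * v p = 0" using F(2)[of p' p] v p by auto
      qed
    qed (use U in auto)
    finally show "u f = 0" using F(1)[of p p] p by simp
  qed
  define V where "V = evaluation Z ` quadratic_forms"
  \<comment> \<open>The ambient function space is infinite-dimensional; the indicator functions of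
    the points of \<open>Z\<close> bound \<open>V\<close>, so that its basis \<open>Bs\<close> is
    finite.\<close>
  define D where "D = (\<lambda>p x. if x = p then 1 else 0 :: complex) ` Z"
  have "V \<subseteq> fun_space.span D"
  proof
    fix f assume "f \<in> V"
    then have "f = (\<Sum>p\<in>Z. (\<lambda>x. f p * (if x = p then 1 else 0)))"
      using assms(1) by (auto simp: V_def evaluation_def sum_fun_apply if_distrib cong: if_cong)
    moreover have "(\<Sum>p\<in>Z. (\<lambda>x. f p * (if x = p then 1 else 0))) \<in> fun_space.span D"
      by (intro fun_space.span_sum fun_space.span_scale fun_space.span_base) (auto simp: D_def)
    ultimately show "f \<in> fun_space.span D" by simp
  qed
  moreover obtain Bs where Bs: "Bs \<subseteq> V" "fun_space.independent Bs" "V \<subseteq> fun_space.span Bs"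
      "card Bs = fun_space.dim V"
    using fun_space.basis_exists by blast
  ultimately have "finite Bs"
    using fun_space.independent_span_bound[of D Bs] assms(1) by (auto simp: D_def)
  moreover have "F ` S \<subseteq> fun_space.span Bs"
    using Bs(3) q(1) by (auto simp: F_def V_def)
  ultimately have "card (F ` S) \<le> card Bs"
    using fun_space.independent_span_bound[OF _ ind] by blast
  then show ?thesis using inj Bs(4) by (simp add: card_image hilbert2_def V_def)
qed

text \<open>A quadric through \<open>A\<close> missing \<open>z\<close> would separate
  \<open>z\<close> from \<open>A\<close>. With the separating quadrics of \<open>A\<close>, this
  gives \<open>2n + 2\<close> independent conditions, against the bound on
  \<open>hilbert2 Z\<close>.\<close>

lemma quadric_through_subset:
  fixes Z :: "(complex^'m) set set"
  assumes Z: "finite Z" "inj_on rep Z" "hilbert2 Z + 1 \<le> 2 * CARD('m)"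
    and A: "A \<subseteq> Z" "card A + 1 = 2 * CARD('m)" "general_position (rep ` A)"
    and q: "q \<in> quadratic_forms" "\<And>a. a \<in> A \<Longrightarrow> q (rep a) = 0" and z: "z \<in> Z"
  shows "q (rep z) = 0"
proof (rule ccontr)
  assume nz: "q (rep z) \<noteq> 0"
  have finA: "finite A" using A(1) Z(1) by (rule finite_subset)
  have inj: "inj_on rep A" using Z(2) A(1) by (rule inj_on_subset)
  have zA: "z \<notin> A" using nz q(2) by blast
  have "card (insert z A) \<le> hilbert2 Z"
  proof (rule card_le_hilbert2)
    fix p assume p: "p \<in> insert z A"
    show "\<exists>q\<in>quadratic_forms. q (rep p) \<noteq> 0 \<and> (\<forall>p'\<in>insert z A - {p}. q (rep p') = 0)"
    proof (cases "p = z")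
      case True
      then show ?thesis using nz q by auto
    next
      case False
      then have pA: "p \<in> A" using p by simp
      have "card (rep ` A) + 1 = 2 * CARD('m)" using A(2) inj by (simp add: card_image)
      then obtain g where g: "g \<in> quadratic_forms" "g (rep p) \<noteq> 0"
        "\<And>b. b \<in> rep ` A - {rep p} \<Longrightarrow> g b = 0"
        using separating_quadric[OF A(3), of "rep p"] pA by blast
      \<comment> \<open>The multiple of \<open>q\<close> makes the value at \<open>z\<close> vanish
        and leaves the values on \<open>A\<close> unchanged.\<close>
      define h where "h = (\<lambda>v. g v + (- g (rep z) / q (rep z)) * q v)"
      have "h (rep p') = 0" if p': "p' \<in> insert z A - {p}" for p'
      proof (cases "p' = z")
        case True
        then show ?thesis using nz by (simp add: h_def)
      next
        case False
        then have p'A: "p' \<in> A" using p' by blast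
        then have "rep p' \<noteq> rep p" using p' pA inj by (metis DiffD2 inj_onD singletonI)
        then show ?thesis using g(3)[of "rep p'"] q(2)[OF p'A] p'A by (simp add: h_def)
      qed
      moreover have "h (rep p) \<noteq> 0" using g(2) q(2)[OF pA] by (simp add: h_def)
      moreover have "h \<in> quadratic_forms"
        unfolding h_def by (rule quadratic_forms_linear[OF g(1) q(1)])
      ultimately show ?thesis by blast
    qed
  qed (use Z A z in auto)
  then show False using Z(3) A(2) zA finA by simp
qed

section \<open>Adjoining points\<close>

text \<open>If \<open>z\<close> lies in a hyperplane \<open>y = 0\<close> spanned by \<open>T \<subseteq> A\<close>, the quadric \<open>x\<^sub>a x\<^sub>a\<^sub>' + y l\<close> vanishes on \<open>T\<close>,
  and \<open>l\<close> can be chosen to make it vanish on \<open>A - T\<close> as well, since \<open>A - T\<close> is a basis; so at most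
  one coordinate of \<open>z\<close> is nonzero.\<close>

lemma general_position_insert:
  fixes A :: "(complex^'m) set"
  assumes A: "general_position A" "card A + 1 = 2 * CARD('m)"
    and z: "\<And>a. a \<in> A \<Longrightarrow> z \<notin> vec.span {a}"
    and quad: "\<And>q. \<lbrakk>q \<in> quadratic_forms; \<And>a. a \<in> A \<Longrightarrow> q a = 0\<rbrakk> \<Longrightarrow> q z = 0"
  shows "general_position (insert z A)"
  unfolding general_position_def
proof (intro conjI allI impI)
  note finA = general_position_finite[OF A(1)]
  show "finite (insert z A)" using finA by simp
  fix S assume S: "S \<subseteq> insert z A" "card S \<le> CARD('m)"
  have zA: "z \<notin> A" using z vec.span_base by blast
  have A_ne: "A \<noteq> {}" using A(2) zero_less_card_finite[where 'a='m] by auto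
  show "vec.independent S"
  proof (cases "z \<in> S")
    case False
    then show ?thesis using S A by (intro general_position_independent[OF A(1)]) auto
  next
    case True
    have finS: "finite S" using S(1) finA finite_subset by blast
    define R where "R = S - {z}"
    have R: "R \<subseteq> A" "card R \<le> CARD('m) - 1" using S True finS by (auto simp: R_def)
    have indR: "vec.independent R" using R by (intro general_position_independent[OF A(1)]) auto
    have "z \<notin> vec.span R"
    proof
      assume "z \<in> vec.span R"
      obtain T where T: "R \<subseteq> T" "T \<subseteq> A" "card T = CARD('m) - 1"
        using exists_subset_between[OF R(2) _ R(1) finA] A(2) by force
      have cT: "card T + 1 = CARD('m)" using T(3) zero_less_card_finite[where 'a='m] by simp
      have finT: "finite T" using T(2) finA finite_subset by blast
      have zT: "z \<in> vec.span T" using \<open>z \<in> vec.span R\<close> vec.span_mono[OF T(1)] by blast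
      have "T \<noteq> A" using cT A(2) zero_less_card_finite[where 'a='m] by auto
      then obtain c where c: "c \<in> A - T" using T(2) by blast
      define E where "E = insert c T"
      have E: "card E = CARD('m)" "E \<subseteq> A" using c T cT finT by (auto simp: E_def)
      have indE: "vec.independent E" using E by (intro general_position_independent[OF A(1)]) auto
      obtain x where x: "\<And>e. linear_form (x e)" "\<And>v. v = (\<Sum>e\<in>E. x e v *s e)"
        "\<And>e e'. e' \<in> E \<Longrightarrow> x e e' = (if e = e' then 1 else 0)"
        by (rule dual_basis[OF indE E(1)], rule that)
      define y where "y = x c"
      have y: "linear_form y" using x(1) by (simp add: y_def)
      have yT: "y v = 0" if "v \<in> T" for v using x(3)[of v c] that c by (auto simp: y_def E_def)
      have yz: "y z = 0" using linear_form_eq_0_on_span[OF x(1) _ zT, of c] yT by (simp add: y_def)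
      have yA: "y b \<noteq> 0" if "b \<in> A - T" for b
        using hyperplane_avoids[OF A(1) T(2) cT that, of y c] x(1,3) yT by (simp add: y_def E_def)
      have "card (A - T) \<le> CARD('m)" using finT T(2) cT A(2) by (simp add: card_Diff_subset)
      then have indAT: "vec.independent (A - T)" by (intro general_position_independent[OF A(1)]) auto
      have prod: "x a z * x a' z = 0" if aa': "a \<in> T" "a' \<in> T" "a \<noteq> a'" for a a'
      proof -
        obtain l where "linear_form l"
          and l: "(\<lambda>v. x a v * x a' v + y v * l v) \<in> quadratic_forms"
          "\<And>v. v \<in> A - T \<Longrightarrow> x a v * x a' v + y v * l v = 0"
          by (rule quadric_through_independent[OF x(1)[of a] x(1)[of a'] y indAT], erule yA, rule that)
        have "x a v * x a' v + y v * l v = 0" if "v \<in> A" for v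
        proof (cases "v \<in> T")
          case True
          then show ?thesis using yT[OF True] x(3)[of v a] x(3)[of v a'] aa'(3) by (auto simp: E_def)
        qed (use l that in auto)
        then have "x a z * x a' z + y z * l z = 0" using quad[OF l(1)] by blast
        then show ?thesis using yz by simp
      qed
      have z_sum: "z = (\<Sum>e\<in>T. x e z *s e)"
      proof -
        have "z = (\<Sum>e\<in>E. x e z *s e)" by (rule x(2))
        also have "\<dots> = x c z *s c + (\<Sum>e\<in>T. x e z *s e)" unfolding E_def using c finT by simp
        finally show ?thesis using yz by (simp add: y_def)
      qed
      have "\<exists>a\<in>A. z \<in> vec.span {a}"
      proof (cases "\<exists>a\<in>T. x a z \<noteq> 0")
        case True
        then obtain a where a: "a \<in> T" "x a z \<noteq> 0" by blast
        have "(\<Sum>e\<in>T. x e z *s e) = (\<Sum>e\<in>{a}. x e z *s e)"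
        proof (rule sum.mono_neutral_right[OF finT])
          show "\<forall>e\<in>T - {a}. x e z *s e = 0" using prod a by fastforce
        qed (use a in auto)
        then have "z = x a z *s a" using z_sum by simp
        then have "z \<in> vec.span {a}" by (metis vec.span_base vec.span_scale singletonI)
        then show ?thesis using a T by blast
      next
        case False
        then have "z = 0" using z_sum by simp
        then show ?thesis using A_ne vec.span_zero by blast
      qed
      then show False using z by blast
    qed
    then have "vec.independent (insert z R)" using indR by (rule vec.independent_insertI)
    then show ?thesis using True by (simp add: R_def insert_absorb)
  qed
qed

text \<open>The bound on the Hilbert function enters the rest of the argument in this form. All
  \<open>A\<close> are quantified, because the exchange of points and the construction of the curve
  use subsets other than the given one.\<close>

definition quadrics_extend :: "(complex^'m) set \<Rightarrow> bool" where
  "quadrics_extend X \<longleftrightarrow>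
     (\<forall>A\<subseteq>X. card A + 1 = 2 * CARD('m) \<longrightarrow> general_position A \<longrightarrow>
       (\<forall>q\<in>quadratic_forms. (\<forall>a\<in>A. q a = 0) \<longrightarrow> (\<forall>v\<in>X. q v = 0)))"

lemma quadrics_extendD:
  "\<lbrakk>quadrics_extend (X :: (complex^'m) set); A \<subseteq> X; card A + 1 = 2 * CARD('m); general_position A;
    q \<in> quadratic_forms; \<And>a. a \<in> A \<Longrightarrow> q a = 0; v \<in> X\<rbrakk> \<Longrightarrow> q v = 0"
  unfolding quadrics_extend_def by blast

text \<open>Elements of \<open>S - A\<close> move into \<open>A\<close> one at a time:
  \<open>general_position_insert\<close> adjoins \<open>s\<close>, some \<open>a\<close> outside
  \<open>S\<close> is dropped to restore the cardinality, and finally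
  \<open>S \<subseteq> A\<close>.\<close>

lemma general_position_exchange:
  fixes X :: "(complex^'m) set"
  assumes X: "finite X" "\<And>u v. \<lbrakk>u \<in> X; v \<in> X; u \<noteq> v\<rbrakk> \<Longrightarrow> u \<notin> vec.span {v}"
    and quad: "quadrics_extend X"
    and S: "S \<subseteq> X" "card S \<le> CARD('m)"
  shows "\<lbrakk>A \<subseteq> X; card A + 1 = 2 * CARD('m); general_position A\<rbrakk> \<Longrightarrow> vec.independent S"
proof (induction "card (S - A)" arbitrary: A)
  case 0
  have "finite S" using S X(1) finite_subset by blast
  then have "S \<subseteq> A" using 0 by simp
  then show ?case using general_position_independent[OF 0(4)] S by blast
next
  case (Suc k)
  have finS: "finite S" using S X(1) finite_subset by blast
  have finA: "finite A" using Suc.prems(3) by (rule general_position_finite)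
  obtain s where s: "s \<in> S - A"
    using Suc(2) by (metis card.empty nat.distinct(1) ex_in_conv)
  \<comment> \<open>Otherwise \<open>S\<close> would contain the \<open>2n + 2\<close> elements of
    \<open>insert s A\<close>, more than the allowed \<open>n + 1\<close>.\<close>
  have "\<not> A \<subseteq> S"
  proof
    assume "A \<subseteq> S"
    then have "insert s A \<subseteq> S" using s by blast
    then have "card (insert s A) \<le> card S" by (rule card_mono[OF finS])
    then show False using s finA Suc.prems(2) S(2) zero_less_card_finite[where 'a='m] by simp
  qed
  then obtain a where a: "a \<in> A - S" by blast
  define A' where "A' = insert s (A - {a})"
  have gp: "general_position (insert s A)"
  proof (rule general_position_insert[OF Suc.prems(3,2)])
    show "s \<notin> vec.span {a}" if "a \<in> A" for a
      using that s S Suc.prems(1) by (intro X(2)) auto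
    show "q s = 0" if "q \<in> quadratic_forms" "\<And>a. a \<in> A \<Longrightarrow> q a = 0" for q
      using quadrics_extendD[OF quad Suc.prems that] s S by blast
  qed
  show ?case
  proof (rule Suc.hyps(1))
    have "S - A' = (S - A) - {s}" using a by (auto simp: A'_def)
    then show "k = card (S - A')" using Suc(2) s finS by simp
    show "A' \<subseteq> X" using s S Suc.prems(1) by (auto simp: A'_def)
    have "0 < card A" using a finA by (auto simp: card_gt_0_iff)
    then show "card A' + 1 = 2 * CARD('m)" using a s finA Suc.prems(2) by (auto simp: A'_def)
    show "general_position A'" by (rule general_position_subset[OF gp]) (auto simp: A'_def)
  qed
qed

section \<open>The curve\<close>

definition binary_form :: "nat \<Rightarrow> ('a::comm_ring_1 \<Rightarrow> 'a \<Rightarrow> 'a) \<Rightarrow> bool" where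
  "binary_form d f \<longleftrightarrow> (\<exists>c. \<forall>s r. f s r = (\<Sum>i\<le>d. c i * (s ^ (d - i) * r ^ i)))"

lemma binary_form_linear_mult:
  assumes "binary_form d f"
  shows "binary_form (Suc d) (\<lambda>s r. (a * s + b * r) * f s r)"
proof -
  obtain c where c: "\<And>s r. f s r = (\<Sum>i\<le>d. c i * (s ^ (d - i) * r ^ i))"
    using assms unfolding binary_form_def by blast
  \<comment> \<open>Coefficients of \<open>a * s * f s r\<close>, padded by 0 at the top, and in
    \<open>v\<close> those of \<open>b * r * f s r\<close>, shifted by one.\<close>
  define u where "u = (\<lambda>i. if i \<le> d then a * c i else 0)"
  define v where "v = (\<lambda>i. case i of 0 \<Rightarrow> 0 | Suc j \<Rightarrow> b * c j)"
  have "(a * s + b * r) * f s r = (\<Sum>i\<le>Suc d. (u i + v i) * (s ^ (Suc d - i) * r ^ i))" for s r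
  proof -
    have "(\<Sum>i\<le>Suc d. u i * (s ^ (Suc d - i) * r ^ i)) = a * s * f s r"
      unfolding sum.atMost_Suc c
      by (simp add: u_def sum_distrib_left Suc_diff_le algebra_simps)
    moreover have "(\<Sum>i\<le>Suc d. v i * (s ^ (Suc d - i) * r ^ i)) = b * r * f s r"
      unfolding sum.atMost_Suc_shift c
      by (simp add: v_def sum_distrib_left algebra_simps)
    ultimately show ?thesis
      by (simp only: distrib_right sum.distrib)
  qed
  then show ?thesis unfolding binary_form_def by (intro exI[of _ "\<lambda>i. u i + v i"]) blast
qed

lemma binary_form_prod:
  assumes "finite S"
  shows "binary_form (card S) (\<lambda>s r. \<Prod>k\<in>S. (a k * s + b k * r))"
  using assms
proof (induction S rule: finite_induct)
  case empty
  have "binary_form 0 (\<lambda>s r. 1)"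
    unfolding binary_form_def by (intro exI[of _ "\<lambda>_. 1"]) simp
  then show ?case by simp
qed (simp add: binary_form_linear_mult)

text \<open>Each coordinate of the right side is a combination of the monomials of degree
  \<open>n\<close>, which are the coordinates of \<open>veronese e s r\<close>; their coefficients
  are the entries of \<open>G\<close>.\<close>

lemma veronese_coordinates:
  fixes f :: "complex^'m \<Rightarrow> complex \<Rightarrow> complex \<Rightarrow> complex" and e :: "'m \<Rightarrow> nat"
  assumes e: "bij_betw e UNIV {0..<CARD('m)}"
    and f: "\<And>k. k \<in> E \<Longrightarrow> binary_form (CARD('m) - 1) (f k)"
  shows "\<exists>G :: complex^'m^'m. \<forall>s r. G *v veronese e s r = (\<Sum>k\<in>E. f k s r *s k)"
proof -
  obtain c where c: "\<And>k s r. k \<in> E \<Longrightarrow>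
      f k s r = (\<Sum>i\<le>CARD('m) - 1. c k i * (s ^ (CARD('m) - 1 - i) * r ^ i))"
    using f unfolding binary_form_def by metis
  have "{..CARD('m) - 1} = {0..<CARD('m)}"
    by (simp add: atLeast0LessThan lessThan_Suc_atMost[symmetric])
  then have fe: "f k s r = (\<Sum>j\<in>UNIV. c k (e j) * (s ^ (CARD('m) - 1 - e j) * r ^ e j))"
    if "k \<in> E" for k s r
    using c[OF that] sum.reindex_bij_betw[OF e, of "\<lambda>i. c k i * (s ^ (CARD('m) - 1 - i) * r ^ i)"]
    by simp
  define G :: "complex^'m^'m" where "G = (\<chi> i j. \<Sum>k\<in>E. c k (e j) * k $ i)"
  have "G *v veronese e s r = (\<Sum>k\<in>E. f k s r *s k)" for s r
  proof (intro vec_eq_iff[THEN iffD2] allI)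
    fix i
    have "(G *v veronese e s r) $ i
        = (\<Sum>j\<in>UNIV. \<Sum>k\<in>E. c k (e j) * (s ^ (CARD('m) - 1 - e j) * r ^ e j) * k $ i)"
      by (simp add: G_def veronese_def matrix_vector_mult_def sum_distrib_left sum_distrib_right mult_ac)
    also have "\<dots> = (\<Sum>k\<in>E. \<Sum>j\<in>UNIV. c k (e j) * (s ^ (CARD('m) - 1 - e j) * r ^ e j) * k $ i)"
      by (rule sum.swap)
    also have "\<dots> = (\<Sum>k\<in>E. f k s r *s k) $ i"
      by (simp add: fe sum_distrib_right)
    finally show "(G *v veronese e s r) $ i = (\<Sum>k\<in>E. f k s r *s k) $ i" .
  qed
  then show ?thesis by blast
qed

text \<open>The range of \<open>G\<close> is a subspace containing \<open>E\<close>. Thus the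
  parametrizing matrix is invertible once the curve passes through a basis.\<close>

lemma invertible_if_range_spans:
  fixes G :: "complex^'m^'m"
  assumes "vec.span E = UNIV" and E: "\<And>v. v \<in> E \<Longrightarrow> \<exists>w. v \<in> vec.span {G *v w}"
  shows "invertible G"
proof -
  have sub: "vec.subspace (range (\<lambda>v. G *v v))"
    by (rule vec.linear_subspace_image[OF matrix_vector_mul_linear_gen vec.subspace_UNIV])
  have "E \<subseteq> range (\<lambda>v. G *v v)"
  proof
    fix v assume "v \<in> E"
    then obtain w where "v \<in> vec.span {G *v w}" using E by blast
    moreover have "vec.span {G *v w} \<subseteq> range (\<lambda>v. G *v v)"
      by (rule vec.span_minimal[OF _ sub]) simp
    ultimately show "v \<in> range (\<lambda>v. G *v v)" by blast
  qed
  then have "range (\<lambda>v. G *v v) = UNIV" using vec.span_minimal[OF _ sub, of E] assms(1) by blast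
  then show ?thesis by (simp add: invertible_right_inverse matrix_right_invertible_surjective)
qed

section \<open>The rational normal curve through vectors in general position\<close>

lemma linear_form_lincomb:
  assumes "\<And>k. k \<in> S \<Longrightarrow> linear_form (x k)"
  shows "linear_form (\<lambda>v. \<Sum>k\<in>S. c k * x k v)"
  unfolding linear_form_def
proof
  show "(\<Sum>k\<in>S. c k * x k (u + v)) = (\<Sum>k\<in>S. c k * x k u) + (\<Sum>k\<in>S. c k * x k v)" for u v
    by (simp add: linear_form_add assms distrib_left sum.distrib)
  show "(\<Sum>k\<in>S. c k * x k (r *s v)) = r * (\<Sum>k\<in>S. c k * x k v)" for r v
    by (simp add: linear_form_scale assms sum_distrib_left algebra_simps)
qed

lemma castelnuovo:
  fixes X :: "(complex^'m) set"
  assumes gp: "general_position X" and card_X: "card X > 2 * CARD('m)" and dim: "CARD('m) \<ge> 2"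
    and quad: "quadrics_extend X"
  obtains e :: "'m \<Rightarrow> nat" and G :: "complex^'m^'m"
  where "bij_betw e UNIV {0..<CARD('m)}" "invertible G"
    "\<And>v. v \<in> X \<Longrightarrow> \<exists>s r. (s, r) \<noteq> (0, 0) \<and> v \<in> vec.span {G *v veronese e s r}"
proof -
  note finX = general_position_finite[OF gp]
  have "CARD('m) - 1 \<le> card X" using card_X by simp
  then obtain I where I: "I \<subseteq> X" "card I = CARD('m) - 1" by (rule obtain_subset_with_card_n)
  have card_I: "card I + 1 = CARD('m)" using I(2) dim by simp
  have finI: "finite I" using I(1) finX by (rule finite_subset)
  define B where "B = X - I"
  have card_B: "card B \<ge> card I + 3"
    using card_X card_I I(1) finI by (simp add: B_def card_Diff_subset)
  have finB: "finite B" using finX by (simp add: B_def)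
  have "B \<noteq> {}" using card_B by auto
  then obtain w where w: "w \<in> B" by blast
  \<comment> \<open>One more point \<open>w\<close> of \<open>X\<close> completes \<open>I\<close>
    to a basis; its coordinate \<open>x w\<close> vanishes on \<open>I\<close> and plays the role of
    \<open>y\<close>.\<close>
  define E where "E = insert w I"
  have oI: "w \<notin> I" using w by (simp add: B_def)
  have E: "E \<subseteq> X" "card E = CARD('m)" using I(1) w oI finI card_I by (auto simp: E_def B_def)
  have finE: "finite E" using finI by (simp add: E_def)
  have indE: "vec.independent E" using E by (intro general_position_independent[OF gp]) simp_all
  obtain x where x: "\<And>e. linear_form (x e)" "\<And>v. v = (\<Sum>e\<in>E. x e v *s e)"
    "\<And>e e'. e' \<in> E \<Longrightarrow> x e e' = (if e = e' then 1 else 0)"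
    by (rule dual_basis[OF indE E(2)], rule that)
  have xI: "x e e' = (if e = e' then 1 else 0)" if "e' \<in> I" for e e'
    using x(3) that by (simp add: E_def)
  have xo: "x e w = (if e = w then 1 else 0)" for e using x(3) by (simp add: E_def)
  have y_nz: "x w b \<noteq> 0" if "b \<in> B" for b
    by (rule hyperplane_avoids[OF gp I(1) card_I _ x(1), of _ _ w])
      (use that oI xI xo in \<open>auto simp: B_def\<close>)
  define t where "t = (\<lambda>k v. x k v / x w v)"
  have lincomb: "linear_form (\<lambda>v. \<Sum>k\<in>E. c k * x k v)" for c
    by (rule linear_form_lincomb) (rule x(1))
  have lincomb_E: "(\<Sum>k\<in>E. c k * x k v) = c v" if "v \<in> E" for c v
    using that finE by (simp add: x(3)[OF that] if_distrib[of "\<lambda>z. _ * z"] cong: if_cong)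
  \<comment> \<open>A linear form divided by \<open>x w\<close> is an affine function of the
    \<open>t k\<close>, with constant term \<open>c w\<close>.\<close>
  have lincomb_eq: "(\<Sum>k\<in>E. c k * x k v) = (c w + (\<Sum>k\<in>I. c k * t k v)) * x w v"
    if "v \<in> B" for c v
    using y_nz[OF that] finI oI by (simp add: E_def t_def sum_distrib_right distrib_right)

  interpret affine_system I B t
  proof
    show "finite I" "finite B" "card I + 3 \<le> card B" by fact+
    fix i assume i: "i \<in> I"
    show "inj_on (t i) B"
    proof (rule inj_onI, rule ccontr)
      fix b b' assume b: "b \<in> B" "b' \<in> B" "t i b = t i b'" "b \<noteq> b'"
      \<comment> \<open>Coefficients of \<open>x i - t i b * x w\<close>. Its hyperplane contains
        \<open>b\<close> and \<open>I - {i}\<close>, so by general position it avoids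
        \<open>b'\<close>, and \<open>t i\<close> separates \<open>b\<close> from
        \<open>b'\<close>.\<close>
      define c where "c = (\<lambda>k. if k = i then 1 else if k = w then - t i b else 0)"
      have sum: "(\<Sum>k\<in>E. c k * x k v) = (t i v - t i b) * x w v" if "v \<in> B" for v
      proof -
        have "(\<Sum>k\<in>I. c k * t k v) = (\<Sum>k\<in>{i}. c k * t k v)"
          using i oI finI by (intro sum.mono_neutral_right) (auto simp: c_def)
        then show ?thesis using lincomb_eq[OF that, of c] i oI by (auto simp: c_def)
      qed
      have T: "insert b (I - {i}) \<subseteq> X" "card (insert b (I - {i})) + 1 = CARD('m)"
        "b' \<in> X - insert b (I - {i})"
        using b I(1) i finI card_I card_gt_0_iff[of I] by (auto simp: B_def)
      have "(\<Sum>k\<in>E. c k * x k b') \<noteq> 0"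
      proof (rule hyperplane_avoids[OF gp T lincomb])
        show "(\<Sum>k\<in>E. c k * x k i) \<noteq> 0" using lincomb_E[of i c] i by (simp add: E_def c_def)
        show "(\<Sum>k\<in>E. c k * x k v) = 0" if "v \<in> insert b (I - {i})" for v
        proof (cases "v = b")
          case True
          then show ?thesis using sum[OF b(1)] by simp
        next
          case False
          then show ?thesis using that lincomb_E[of v c] oI by (auto simp: E_def c_def)
        qed
      qed
      then show False using sum[OF b(2)] b(3) by simp
    qed
  next
    fix U d c
    assume U: "U \<subseteq> B" "card U = card I + 1" and zero: "\<And>b. b \<in> U \<Longrightarrow> d + (\<Sum>k\<in>I. c k * t k b) = 0"
    \<comment> \<open>Homogenization, with \<open>d\<close> as coefficient of \<open>x w\<close>;
      the resulting form vanishes on the basis \<open>U\<close>, hence everywhere.\<close>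
    define c' where "c' = c(w := d)"
    have eq: "(\<Sum>k\<in>I. c' k * t k v) = (\<Sum>k\<in>I. c k * t k v)" for v
      using oI by (intro sum.cong) (auto simp: c'_def)
    have "vec.independent U"
      using U card_I by (intro general_position_independent[OF gp]) (auto simp: B_def)
    then have span: "vec.span U = UNIV" using U card_I by (intro span_eq_UNIV) simp_all
    have U0: "(\<Sum>k\<in>E. c' k * x k v) = 0" if "v \<in> U" for v
    proof -
      have "v \<in> B" using that U by blast
      then show ?thesis using zero[OF that] by (simp add: lincomb_eq eq) (simp add: c'_def)
    qed
    have "(\<Sum>k\<in>E. c' k * x k v) = 0" for v
      by (rule linear_form_eq_0_on_span[OF lincomb U0, of U]) (use span in blast)+
    then have c'0: "c' v = 0" if "v \<in> E" for v using lincomb_E[OF that] by metis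
    have "d = 0" using c'0[of w] by (simp add: E_def c'_def)
    moreover have "c k = 0" if "k \<in> I" for k
      using c'0[of k] that oI by (auto simp: E_def c'_def split: if_splits)
    ultimately show "d = 0 \<and> (\<forall>k\<in>I. c k = 0)" by blast
  next
    fix i j assume ij: "i \<in> I" "j \<in> I" "i \<noteq> j"
    have "CARD('m) \<le> card B" using card_B card_I by simp
    then obtain D where D: "D \<subseteq> B" "card D = CARD('m)" by (rule obtain_subset_with_card_n)
    have finD: "finite D" using D(1) finB by (rule finite_subset)
    have indD: "vec.independent D"
      using D by (intro general_position_independent[OF gp]) (auto simp: B_def)
    have y_D: "x w v \<noteq> 0" if "v \<in> D" for v using y_nz that D(1) by blast
    \<comment> \<open>The quadric vanishes on \<open>D\<close> by the choice of \<open>l\<close>,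
      and on \<open>I\<close> because there \<open>x w = 0\<close> and \<open>x i * x j = 0\<close>.
      As \<open>I \<union> D\<close> has \<open>2n + 1\<close> points, it vanishes on
      \<open>X\<close>; division by the square of \<open>x w\<close> gives the affine
      product.\<close>
    obtain l where l: "linear_form l" "(\<lambda>v. x i v * x j v + x w v * l v) \<in> quadratic_forms"
      "\<And>v. v \<in> D \<Longrightarrow> x i v * x j v + x w v * l v = 0"
      by (rule quadric_through_independent[OF x(1)[of i] x(1)[of j] x(1)[of w] indD], erule y_D, rule that)
    have ID: "I \<union> D \<subseteq> X" using I D by (auto simp: B_def)
    have "card (I \<union> D) = card I + card D"
      using D finI finD by (intro card_Un_disjoint) (auto simp: B_def)
    then have card_ID: "card (I \<union> D) + 1 = 2 * CARD('m)" using D(2) card_I by simp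
    have vanish: "x i v * x j v + x w v * l v = 0" if "v \<in> I \<union> D" for v
    proof (cases "v \<in> I")
      case True
      then show ?thesis using oI ij(3) by (auto simp: xI)
    next
      case False
      then show ?thesis using that l(3) by blast
    qed
    have "t i b * t j b = - l w + (\<Sum>k\<in>I. - l k * t k b)" if b: "b \<in> B" for b
    proof -
      have bX: "b \<in> X" using b by (simp add: B_def)
      have q: "x i b * x j b + x w b * l b = 0"
        by (rule quadrics_extendD[OF quad ID card_ID general_position_subset[OF gp ID] l(2) vanish bX])
      have "l b = l (\<Sum>k\<in>E. x k b *s k)" using x(2) by metis
      also have "\<dots> = (\<Sum>k\<in>E. l k * x k b)"
        by (simp add: linear_form_sum[OF l(1)] linear_form_scale[OF l(1)] mult.commute)
      also have "\<dots> = (l w + (\<Sum>k\<in>I. l k * t k b)) * x w b" by (rule lincomb_eq[OF b])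
      finally have lb: "l b = (l w + (\<Sum>k\<in>I. l k * t k b)) * x w b" .
      have "t i b * t j b = - l b / x w b"
        using q y_nz[OF b] by (simp add: t_def field_simps eq_neg_iff_add_eq_0)
      also have "\<dots> = - (l w + (\<Sum>k\<in>I. l k * t k b))" using lb y_nz[OF b] by simp
      finally show ?thesis by (simp add: sum_negf)
    qed
    then show "\<exists>d c. \<forall>b\<in>B. t i b * t j b = d + (\<Sum>k\<in>I. c k * t k b)"
      by (intro exI[of _ "- l w"] exI[of _ "\<lambda>k. - l k"]) blast
  qed

  have "I \<noteq> {}" using card_I dim by auto
  then obtain h where h: "h \<in> I" by blast
  \<comment> \<open>\<open>t h\<close> becomes the parameter of the curve; the coordinates indexed
    by \<open>K\<close> are Moebius functions of it.\<close>
  define K where "K = I - {h}"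
  have finK: "finite K" using finI by (simp add: K_def)
  have K: "k \<in> I" "k \<noteq> h" "k \<noteq> w" if "k \<in> K" for k using that oI by (auto simp: K_def)
  have E_eq: "E = insert w (insert h K)" using h by (auto simp: E_def K_def)
  have card_K: "card K + 1 = card I" using h finI card_gt_0_iff[of I] by (auto simp: K_def)
  have "\<forall>k\<in>K. \<exists>p. \<forall>b\<in>B. t h b * t k b = fst p * t h b + fst (snd p) * t k b + snd (snd p)"
  proof
    fix k assume "k \<in> K"
    then obtain a b c where "\<forall>v\<in>B. t h v * t k v = a * t h v + b * t k v + c"
      using moebius_relation[OF h K(1)] K(2) by metis
    then show "\<exists>p. \<forall>b\<in>B. t h b * t k b = fst p * t h b + fst (snd p) * t k b + snd (snd p)"
      by (intro exI[of _ "(a, b, c)"]) simp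
  qed
  from bchoice[OF this] obtain p where p: "\<forall>k\<in>K. \<forall>b\<in>B.
      t h b * t k b = fst (p k) * t h b + fst (snd (p k)) * t k b + snd (snd (p k))"
    ..
  define \<alpha> \<beta> \<gamma> where "\<alpha> k = fst (p k)" and "\<beta> k = fst (snd (p k))" and "\<gamma> k = snd (snd (p k))" for k
  have rel: "t h b * t k b = \<alpha> k * t h b + \<beta> k * t k b + \<gamma> k" if "k \<in> K" "b \<in> B" for k b
    using p that by (simp add: \<alpha>_def \<beta>_def \<gamma>_def)
  have nondeg: "\<alpha> k * \<beta> k + \<gamma> k \<noteq> 0" if "k \<in> K" for k
    using moebius_nondegenerate[OF h K(1)[OF that] rel[OF that]] .
  have pole: "t h b \<noteq> \<beta> k" if "k \<in> K" "b \<in> B" for k b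
    using moebius_pole_notin_range[OF h K(1)[OF that(1)] rel[OF that(1)] that(2)] .
  have distinct: "\<beta> k \<noteq> \<beta> l" if "k \<in> K" "l \<in> K" "k \<noteq> l" for k l
    using moebius_poles_distinct[OF h K(1)[OF that(1)] K(1)[OF that(2)] that(3) rel[OF that(1)] rel[OF that(2)]] .

  \<comment> \<open>With \<open>t h = s / r\<close> the relations give \<open>t k = (\<alpha> k * s + \<gamma> k * r) / (s - \<beta> k * r)\<close>;
    \<open>f\<close> clears all denominators from the coordinate vector.\<close>
  define P where "P S s r = (\<Prod>k\<in>S. (1 * s + (- \<beta> k) * r))" for S s r
  define f where "f k = (if k = h then (\<lambda>s r. (1 * s + 0 * r) * P K s r)
      else if k = w then (\<lambda>s r. (0 * s + 1 * r) * P K s r)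
      else (\<lambda>s r. (0 * s + 1 * r) * ((\<alpha> k * s + \<gamma> k * r) * P (K - {k}) s r)))" for k
  have f_h: "f h s r = s * P K s r" for s r by (simp add: f_def)
  have f_o: "f w s r = r * P K s r" for s r using h oI by (auto simp: f_def)
  have f_K: "f k s r = r * (\<alpha> k * s + \<gamma> k * r) * P (K - {k}) s r" if "k \<in> K" for k s r
    using K[OF that] by (simp add: f_def)
  have P_form: "binary_form (card S) (P S)" if "finite S" for S
    unfolding P_def using binary_form_prod[OF that, of "\<lambda>_. 1" "\<lambda>k. - \<beta> k"] by (simp add: fun_eq_iff)
  \<comment> \<open>Since \<open>K\<close> has \<open>n - 1\<close> elements, every
    \<open>f k\<close> is a product of \<open>n\<close> linear factors. The explicit coefficients 0
    and 1 in \<open>f\<close> match the shape of \<open>binary_form_linear_mult\<close>.\<close>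
  have f_form: "binary_form (CARD('m) - 1) (f k)" if k: "k \<in> E" for k
  proof (cases "k = h \<or> k = w")
    case True
    have "CARD('m) - 1 = Suc (card K)" using card_I card_K by simp
    then show ?thesis
      using True binary_form_linear_mult[OF P_form[OF finK]] by (auto simp only: f_def if_True if_False split: if_splits)
  next
    case False
    then have kK: "k \<in> K" using k by (simp add: E_eq)
    have "card (K - {k}) + 1 = card K" using kK finK card_gt_0_iff[of K] by auto
    then have "CARD('m) - 1 = Suc (Suc (card (K - {k})))" using card_I card_K by simp
    then show ?thesis
      using False binary_form_linear_mult[OF binary_form_linear_mult[OF P_form[of "K - {k}"]]] finK
      by (simp only: f_def finite_Diff if_False de_Morgan_disj)
  qed
  obtain e :: "'m \<Rightarrow> nat" where e: "bij_betw e UNIV {0..<CARD('m)}"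
    using ex_bij_betw_finite_nat[OF finite_class.finite_UNIV] by blast
  have "\<exists>G :: complex^'m^'m. \<forall>s r. G *v veronese e s r = (\<Sum>k\<in>E. f k s r *s k)"
    by (rule veronese_coordinates[OF e f_form])
  then obtain G :: "complex^'m^'m" where G: "\<And>s r. G *v veronese e s r = (\<Sum>k\<in>E. f k s r *s k)"
    by blast
  have on_curve: "\<exists>s r. (s, r) \<noteq> (0, 0) \<and> v \<in> vec.span {G *v veronese e s r}"
    if s: "(s, r) \<noteq> (0, 0)" "c \<noteq> 0" "\<And>k. k \<in> E \<Longrightarrow> f k s r = c * x k v" for v s r c
  proof -
    have "G *v veronese e s r = (\<Sum>k\<in>E. c *s (x k v *s k))"
      unfolding G using s(3) by (intro sum.cong) simp_all
    also have "\<dots> = c *s (\<Sum>k\<in>E. x k v *s k)" by (simp only: vec.scale_sum_right)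
    also have "\<dots> = c *s v" by (simp only: x(2)[symmetric])
    finally have "v = (1 / c) *s (G *v veronese e s r)" using s(2) by simp
    then have "v \<in> vec.span {G *v veronese e s r}" unfolding vec.span_singleton by blast
    then show ?thesis using s(1) by blast
  qed
  \<comment> \<open>The parameters are \<open>(t h v, 1)\<close> for \<open>v\<close> in
    \<open>B\<close>, the point at infinity \<open>(1, 0)\<close> for \<open>h\<close>, and the pole
    \<open>(\<beta> v, 1)\<close> for \<open>v\<close> in \<open>K\<close>.\<close>
  have cover: "\<exists>s r. (s, r) \<noteq> (0, 0) \<and> v \<in> vec.span {G *v veronese e s r}" if v: "v \<in> X" for v
  proof (cases "v \<in> I")
    case False
    then have vB: "v \<in> B" using v by (simp add: B_def)
    have y: "x w v \<noteq> 0" by (rule y_nz[OF vB])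
    have P0: "P K (t h v) 1 \<noteq> 0" using finK pole[OF _ vB] by (auto simp: P_def)
    show ?thesis
    proof (rule on_curve[of "t h v" 1 "P K (t h v) 1 / x w v"])
      show "P K (t h v) 1 / x w v \<noteq> 0" using P0 y by simp
      fix k assume "k \<in> E"
      then consider "k = w" | "k = h" | "k \<in> K" by (auto simp: E_eq)
      then show "f k (t h v) 1 = P K (t h v) 1 / x w v * x k v"
      proof cases
        case 1
        then show ?thesis using y by (simp add: f_o)
      next
        case 2
        then show ?thesis by (simp add: f_h) (simp add: t_def)
      next
        case 3
        have prod: "P K (t h v) 1 = (t h v - \<beta> k) * P (K - {k}) (t h v) 1"
          unfolding P_def using prod.remove[OF finK 3] by simp
        have "\<alpha> k * t h v + \<gamma> k = (t h v - \<beta> k) * t k v"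
          using rel[OF 3 vB] by (simp add: algebra_simps)
        then have "f k (t h v) 1 = P K (t h v) 1 * t k v"
          unfolding prod f_K[OF 3] by simp
        then show ?thesis by (simp add: t_def)
      qed
    qed simp
  next
    case True
    show ?thesis
    proof (cases "v = h")
      case True
      show ?thesis
      proof (rule on_curve[of 1 0 1])
        fix k assume "k \<in> E"
        then consider "k = w" | "k = h" | "k \<in> K" by (auto simp: E_eq)
        then show "f k 1 0 = 1 * x k v"
          using True oI h K by cases (auto simp: f_o f_h f_K P_def xI)
      qed simp_all
    next
      case False
      then have vK: "v \<in> K" using \<open>v \<in> I\<close> by (simp add: K_def)
      show ?thesis
      proof (rule on_curve[of "\<beta> v" 1 "(\<alpha> v * \<beta> v + \<gamma> v) * P (K - {v}) (\<beta> v) 1"])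
        show "(\<alpha> v * \<beta> v + \<gamma> v) * P (K - {v}) (\<beta> v) 1 \<noteq> 0"
          using nondeg[OF vK] distinct[OF vK] finK by (auto simp: P_def)
        \<comment> \<open>At the pole of \<open>v\<close> every form except \<open>f v\<close>
          contains the vanishing factor indexed by \<open>v\<close>; \<open>f v\<close> survives by
          nondegeneracy and distinctness of the poles.\<close>
        have zero: "P S (\<beta> v) 1 = 0" if "v \<in> S" "finite S" for S
          unfolding P_def using that by (intro prod_zero) auto
        fix k assume "k \<in> E"
        then consider "k = w" | "k = h" | "k \<in> K" "k \<noteq> v" | "k = v" by (auto simp: E_eq)
        then show "f k (\<beta> v) 1 = (\<alpha> v * \<beta> v + \<gamma> v) * P (K - {v}) (\<beta> v) 1 * x k v"
          using vK K[OF vK] finK zero[OF vK] zero[of "K - {k}"] \<open>v \<in> I\<close>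
          by cases (auto simp: f_o f_h f_K xI)
      qed simp
    qed
  qed
  have "invertible G"
    using cover E(1) by (intro invertible_if_range_spans[OF span_eq_UNIV[OF indE E(2)]]) blast
  from that[OF e this cover] show thesis .
qed

section \<open>Projective points\<close>

lemma proj_space_eq_span:
  assumes "p \<in> proj_space" "v \<in> p" "v \<noteq> 0"
  shows "p = vec.span {v}"
proof -
  have p: "vec.subspace p" "vec.dim p = 1" using assms(1) unfolding proj_space_def by auto
  have "vec.independent {v}" using assms(3) by (simp add: vec.independent_insert)
  then have "p \<subseteq> vec.span {v}" using vec.card_ge_dim_independent[of "{v}" p] p assms(2) by simp
  moreover have "vec.span {v} \<subseteq> p" using vec.span_minimal[of "{v}" p] p assms(2) by simp
  ultimately show ?thesis by blast
qed

lemma rep_in: "(p :: (complex^'m) set) \<in> proj_space \<Longrightarrow> rep p \<in> p"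
  and rep_nonzero: "(p :: (complex^'m) set) \<in> proj_space \<Longrightarrow> rep p \<noteq> 0"
proof -
  assume "p \<in> proj_space"
  then have p: "vec.subspace p" "vec.dim p = 1" unfolding proj_space_def by auto
  have "\<not> p \<subseteq> {0}" using p(2) vec.dim_eq_0[of p] by linarith
  then have "\<exists>v. v \<in> p \<and> v \<noteq> 0" by blast
  from someI_ex[OF this] show "rep p \<in> p" "rep p \<noteq> 0" unfolding rep_def by auto
qed

lemma rep_notin_span:
  assumes "p \<in> proj_space" "p' \<in> proj_space" "p \<noteq> p'"
  shows "rep p \<notin> vec.span {rep p'}"
proof
  assume "rep p \<in> vec.span {rep p'}"
  then have "rep p \<in> p'"
    using proj_space_eq_span[OF assms(2) rep_in[OF assms(2)] rep_nonzero[OF assms(2)]] by simp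
  then have "p' = vec.span {rep p}" by (rule proj_space_eq_span[OF assms(2) _ rep_nonzero[OF assms(1)]])
  moreover have "p = vec.span {rep p}"
    by (rule proj_space_eq_span[OF assms(1) rep_in[OF assms(1)] rep_nonzero[OF assms(1)]])
  ultimately show False using assms(3) by simp
qed

lemma inj_on_rep: "Z \<subseteq> proj_space \<Longrightarrow> inj_on rep Z"
proof (intro inj_onI, rule ccontr)
  fix p p' assume "Z \<subseteq> proj_space" "p \<in> Z" "p' \<in> Z" "rep p = rep p'" "p \<noteq> p'"
  then show False using rep_notin_span[of p p'] vec.span_base[of "rep p'" "{rep p'}"] by auto
qed

lemma span_singleton_eq:
  fixes u v :: "complex^'m"
  assumes "u \<in> vec.span {v}" "u \<noteq> 0"
  shows "vec.span {u} = vec.span {v}"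
proof -
  obtain c where c: "u = c *s v" using assms(1) unfolding vec.span_singleton by blast
  then have "v = (1 / c) *s u" using assms(2) by auto
  then have "v \<in> vec.span {u}" unfolding vec.span_singleton by blast
  then show ?thesis using assms(1) by (simp add: vec.span_eq)
qed

text \<open>Distinct points have distinct representatives, so subsets of the image are images of
  subsets of the same size; the size of \<open>Z\<close> turns the minimum into
  \<open>CARD('m)\<close>.\<close>

lemma linear_general_position_iff:
  fixes Z :: "(complex^'m) set set"
  assumes "finite Z" "Z \<subseteq> proj_space" "CARD('m) \<le> card Z"
  shows "linear_general_position Z \<longleftrightarrow> general_position (rep ` Z)"
proof -
  have "card (rep ` S) = card S" if "S \<subseteq> Z" for S
    using inj_on_rep[of S] that assms(2) by (simp add: card_image)
  then show ?thesis
    unfolding linear_general_position_def general_position_def points_independent_def all_subset_image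
    using assms(1,3) by (simp add: min_absorb2)
qed

theorem lemma5p4:
  fixes n :: nat and Z :: "(complex^'m) set set"
  assumes "n \<ge> 1" and "CARD('m) = n + 1"
    and "Z \<subseteq> proj_space" and "finite Z"
    and "card Z \<ge> 2 * n + 3"
    and "hilbert2 Z \<le> 2 * n + 1"
    and "\<exists>A \<subseteq> Z. card A = 2 * n + 1 \<and> linear_general_position A"
  shows "linear_general_position Z \<and> (\<exists>C. rational_normal_curve C \<and> Z \<subseteq> C)"
proof -
  have inj: "inj_on rep Z" using assms(3) by (rule inj_on_rep)
  \<comment> \<open>\<open>quadric_through_subset\<close> concerns sets of points, so the set of
    vectors \<open>A\<close> is first pulled back along \<open>rep\<close>.\<close>
  have quad: "quadrics_extend (rep ` Z)"
    unfolding quadrics_extend_def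
  proof (intro allI impI ballI)
    fix A q v
    assume A: "A \<subseteq> rep ` Z" "card A + 1 = 2 * CARD('m)" "general_position A"
      and q: "q \<in> quadratic_forms" "\<forall>a\<in>A. q a = 0" and v: "v \<in> rep ` Z"
    obtain A' where A': "A' \<subseteq> Z" "A = rep ` A'" using A(1) by (rule subset_imageE)
    then have "card A' = card A" using inj_on_subset[OF inj] by (simp add: card_image)
    then have cA': "card A' + 1 = 2 * CARD('m)" using A(2) by simp
    have gpA': "general_position (rep ` A')" using A(3) A'(2) by simp
    have q': "q (rep a) = 0" if "a \<in> A'" for a using q(2) A'(2) that by blast
    obtain z where z: "z \<in> Z" "v = rep z" using v by blast
    have hZ: "hilbert2 Z + 1 \<le> 2 * CARD('m)" using assms(2,6) by simp
    have "q (rep z) = 0"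
      by (rule quadric_through_subset[OF assms(4) inj hZ A'(1) cA' gpA' q(1) q' z(1)])
    then show "q v = 0" using z(2) by simp
  qed
  obtain A where A: "A \<subseteq> Z" "card A = 2 * n + 1" "linear_general_position A" using assms(7) by blast
  have gpA: "general_position (rep ` A)"
    using A assms linear_general_position_iff[of A] finite_subset[OF A(1)] by auto
  have cA: "card (rep ` A) + 1 = 2 * CARD('m)"
    using A assms(2) inj_on_subset[OF inj A(1)] by (simp add: card_image)
  have gpZ: "general_position (rep ` Z)"
    unfolding general_position_def
  proof (intro conjI allI impI)
    show "finite (rep ` Z)" using assms(4) by simp
    fix S assume S: "S \<subseteq> rep ` Z" "card S \<le> CARD('m)"
    show "vec.independent S"
    proof (rule general_position_exchange[OF _ _ quad S _ cA gpA])
      show "u \<notin> vec.span {v}" if "u \<in> rep ` Z" "v \<in> rep ` Z" "u \<noteq> v" for u v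
        using that assms(3) rep_notin_span by blast
    qed (use assms(4) A(1) in auto)
  qed
  have cZ: "card (rep ` Z) > 2 * CARD('m)" using assms(2,5) inj by (simp add: card_image)
  have dim: "CARD('m) \<ge> 2" using assms(1,2) by simp
  obtain e :: "'m \<Rightarrow> nat" and G :: "complex^'m^'m"
    where e: "bij_betw e UNIV {0..<CARD('m)}" and G: "invertible G"
    and cover: "\<And>v. v \<in> rep ` Z \<Longrightarrow> \<exists>s r. (s, r) \<noteq> (0, 0) \<and> v \<in> vec.span {G *v veronese e s r}"
    by (rule castelnuovo[OF gpZ cZ dim quad], rule that)
  define C where "C = (\<lambda>p. (\<lambda>v. G *v v) ` p) ` veronese_curve e"
  have "Z \<subseteq> C"
  proof
    fix p assume p: "p \<in> Z"
    then have pp: "p \<in> proj_space" using assms(3) by blast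
    obtain s r where s: "(s, r) \<noteq> (0, 0)" and v: "rep p \<in> vec.span {G *v veronese e s r}"
      using cover p by blast
    \<comment> \<open>The point is the span of its representative, hence the image under
      \<open>G\<close> of a point of the Veronese curve.\<close>
    have "p = vec.span {rep p}" by (rule proj_space_eq_span[OF pp rep_in[OF pp] rep_nonzero[OF pp]])
    also have "\<dots> = vec.span ((\<lambda>v. G *v v) ` {veronese e s r})"
      using span_singleton_eq[OF v rep_nonzero[OF pp]] by simp
    also have "\<dots> = (\<lambda>v. G *v v) ` vec.span {veronese e s r}"
      by (rule vec.linear_span_image[OF matrix_vector_mul_linear_gen])
    finally show "p \<in> C" using s unfolding C_def veronese_curve_def by blast
  qed
  moreover have "rational_normal_curve C"
    unfolding rational_normal_curve_def C_def using e G by blast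
  moreover have "linear_general_position Z"
    using linear_general_position_iff[OF assms(4,3)] gpZ assms(2,5) by simp
  ultimately show ?thesis by blast
qed

end
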